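(* Let $\mathfrak{G}=(g_0:\cdots:g_n)$ be a Cremona map of $\mathbb{P}^n$ of degree $d$ with base ideal $I=(g_0,\ldots,g_n)\subset R=k[x_0,\ldots,x_n]$, and let $g'_0,\ldots,g'_n\in k[y_0,\ldots,y_n]$ be forms of the same degree with $\gcd$ $1$ defining the inverse map. Let $f,g\in R$ be forms with $\deg(f)\ge1$, $\deg(g)=d+\deg(f)$ and $\gcd(f,g)=1$, and let $J=(If,g)=(fg_0,\ldots,fg_n,g)$. Then the defining ideal in $k[x_0,\ldots,x_n,y_0,\ldots,y_{n+1}]$ of the Rees algebra of $J$ (with respect to the generators $fg_0,\ldots,fg_n,g$) is a minimal prime of the ideal $$\mathfrak{D}:=\left(\mathcal{I},\ \{D^{(\ell)}_{g'_0,\ldots,g'_n}(Q),\ 0\le\ell\le\deg_{\mathbf x}(Q)\}\right),$$ where $\mathcal{I}$ stands for the defining ideal of the Rees algebra $\mathcal{R}_R(I)$ (with respect to $g_0,\ldots,g_n$) and $Q$ runs through the biforms corresponding to the syzygies of $J$ with nonzero last coordinate.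
   Context: $k$ is an infinite field; $\mathbf x=(x_0,\ldots,x_n)$, $\mathbf y=(y_0,\ldots,y_n)$. A Cremona map $\mathfrak G=(g_0:\cdots:g_n)$ of degree $d\ge1$ is a birational map of $\mathbb{P}^n$ onto itself given by forms $g_i\in R$ of the same degree $d$ without nonconstant common factor. The defining (presentation) ideal of the Rees algebra of an ideal $(a_0,\ldots,a_m)\subset R$ with respect to these generators is the kernel of $R[y_0,\ldots,y_m]\to R[t]$, $y_i\mapsto a_it$. The defining ideal $\mathcal I\subset k[\mathbf x,\mathbf y]$ of $\mathcal R_R(I)$ is regarded inside $k[\mathbf x,\mathbf y,y_{n+1}]$ by extension. The biform corresponding to a homogeneous syzygy $(s_0,\ldots,s_{n+1})\in R^{n+2}$ of the generators $fg_0,\ldots,fg_n,g$ of $J$ is $Q=\sum_{i=0}^{n+1}s_iy_i\in k[\mathbf x,\mathbf y,y_{n+1}]$; its last coordinate is $s_{n+1}$. Downgrading: given forms $\mathfrak H=\{\mathfrak h_0,\ldots,\mathfrak h_n\}\subset k[\mathbf y]$ of the same degree and a bihomogeneous polynomial $Q$ (in $\mathbf x$ and in $(\mathbf y,y_{n+1})$) of positive $\mathbf x$-degree, write $Q=\sum_{r\ge0}Q_r(\mathbf x,\mathbf y)y_{n+1}^r$ and choose bihomogeneous $Q_{r,i}(\mathbf x,\mathbf y)$ with $Q_r=\sum_{i=0}^nx_iQ_{r,i}$ (an $\mathbf x$-framing); an $\mathfrak H$-downgraded polynomial of $Q$ is $D_{\mathfrak H}(Q)=\sum_{r\ge0}\big(\sum_{i=0}^n\mathfrak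 h_iQ_{r,i}\big)y_{n+1}^r$. It depends on the choice of framing; any choice is allowed. The iterates are $D^{(0)}_{\mathfrak H}(Q)=Q$ and $D^{(\ell)}_{\mathfrak H}(Q)=D_{\mathfrak H}(D^{(\ell-1)}_{\mathfrak H}(Q))$. Here $\mathfrak H=\{g'_0,\ldots,g'_n\}$. $\deg_{\mathbf x}(Q)$ is the degree of $Q$ in the variables $\mathbf x$. *)

theory Defs
  imports "HOL-Library.Poly_Mapping" "HOL-Computational_Algebra.Polynomial"
begin

section \<open>Polynomials in finitely many variables\<close>

text \<open>
  The polynomial ring over \<open>'k\<close> whose variables are indexed by the finite type \<open>'v\<close>.
  A polynomial maps exponent vectors to coefficients.
\<close>

type_synonym ('v, 'k) mpoly = "('v \<Rightarrow>\<^sub>0 nat) \<Rightarrow>\<^sub>0 'k"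

definition Const :: "'k::zero \<Rightarrow> ('v, 'k) mpoly" where
  "Const c = Poly_Mapping.single 0 c"

definition Var :: "'v \<Rightarrow> ('v, 'k::zero_neq_one) mpoly" where
  "Var v = Poly_Mapping.single (Poly_Mapping.single v 1) 1"

definition subst :: "('k \<Rightarrow> 'a::comm_semiring_1) \<Rightarrow> ('v \<Rightarrow> 'a) \<Rightarrow> ('v::finite, 'k::zero) mpoly \<Rightarrow> 'a" where
  "subst c u p =
     (\<Sum>m\<in>Poly_Mapping.keys p.
        c (Poly_Mapping.lookup p m) * (\<Prod>v\<in>UNIV. u v ^ Poly_Mapping.lookup m v))"

definition rename :: "('v \<Rightarrow> 'w) \<Rightarrow> ('v::finite, 'k::comm_semiring_1) mpoly \<Rightarrow> ('w, 'k) mpoly" where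
  "rename \<phi> = subst Const (\<lambda>v. Var (\<phi> v))"

text \<open>The zero polynomial is homogeneous of every degree.\<close>

definition homogeneous :: "nat \<Rightarrow> ('v::finite, 'k::zero) mpoly \<Rightarrow> bool" where
  "homogeneous d p \<longleftrightarrow>
     (\<forall>m\<in>Poly_Mapping.keys p. (\<Sum>v\<in>UNIV. Poly_Mapping.lookup m v) = d)"

text \<open>
  The divisors of \<open>1\<close> are the nonzero constants, so this says that the polynomials in \<open>A\<close>
  have no nonconstant common factor. It fails if all of them are zero
  (and there is at least one variable).
\<close>

definition gcd_one :: "('v, 'k::comm_semiring_1) mpoly set \<Rightarrow> bool" where
  "gcd_one A \<longleftrightarrow> (\<forall>p. (\<forall>a\<in>A. p dvd a) \<longrightarrow> p dvd 1)"


section \<open>Ideals\<close>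

definition is_ideal :: "'a::comm_ring_1 set \<Rightarrow> bool" where
  "is_ideal = module.subspace (*)"

definition ideal_of :: "'a::comm_ring_1 set \<Rightarrow> 'a set" where
  "ideal_of = module.span (*)"

definition prime_ideal :: "'a::comm_ring_1 set \<Rightarrow> bool" where
  "prime_ideal P \<longleftrightarrow>
     is_ideal P \<and> P \<noteq> UNIV \<and> (\<forall>a b. a * b \<in> P \<longrightarrow> a \<in> P \<or> b \<in> P)"

definition minimal_prime_of :: "'a::comm_ring_1 set \<Rightarrow> 'a set \<Rightarrow> bool" where
  "minimal_prime_of A P \<longleftrightarrow>
     prime_ideal P \<and> A \<subseteq> P \<and> (\<forall>P'. prime_ideal P' \<and> A \<subseteq> P' \<and> P' \<subseteq> P \<longrightarrow> P' = P)"


section \<open>Cremona maps\<close>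

text \<open>
  With \<open>CARD('n) = n + 1\<close>, a rational map from projective \<open>n\<close>-space to itself is represented by a
  family of \<open>n + 1\<close> forms of the same degree, not all zero. Two families represent the same map iff
  they are proportional, i.e. iff their \<open>2 \<times> 2\<close> minors vanish.
\<close>

definition same_rational_map ::
    "('n \<Rightarrow> ('n, 'k::comm_ring_1) mpoly) \<Rightarrow> ('n \<Rightarrow> ('n, 'k) mpoly) \<Rightarrow> bool" where
  "same_rational_map a b \<longleftrightarrow>
     (\<exists>i. a i \<noteq> 0) \<and> (\<exists>i. b i \<noteq> 0) \<and> (\<forall>i j. a i * b j = a j * b i)"

text \<open>First \<open>b\<close>, then \<open>a\<close>; the composite of the rational maps is defined if this is not the zero family.\<close>

definition composite ::
    "('n::finite \<Rightarrow> ('n, 'k::comm_ring_1) mpoly) \<Rightarrow> ('n \<Rightarrow> ('n, 'k) mpoly) \<Rightarrow> 'n \<Rightarrow> ('n, 'k) mpoly" where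
  "composite a b = (\<lambda>i. subst Const b (a i))"

definition inverse_rational_maps ::
    "('n::finite \<Rightarrow> ('n, 'k::comm_ring_1) mpoly) \<Rightarrow> ('n \<Rightarrow> ('n, 'k) mpoly) \<Rightarrow> bool" where
  "inverse_rational_maps a b \<longleftrightarrow>
     same_rational_map (composite b a) Var \<and> same_rational_map (composite a b) Var"

definition cremona_map :: "nat \<Rightarrow> ('n::finite \<Rightarrow> ('n, 'k::comm_ring_1) mpoly) \<Rightarrow> bool" where
  "cremona_map d a \<longleftrightarrow>
     d \<ge> 1 \<and> (\<forall>i. homogeneous d (a i)) \<and> gcd_one (range a) \<and>
     (\<exists>e b. (\<forall>i. homogeneous e (b i)) \<and> inverse_rational_maps a b)"


section \<open>Rees algebras\<close>

text \<open>
  The ring \<open>k[x, y]\<close>, with the \<open>x\<close>-variables indexed by \<open>'n\<close> and the \<open>y\<close>-variables by \<open>'m\<close>.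
  For \<open>k[x\<^sub>0,\<dots>,x\<^sub>n,y\<^sub>0,\<dots>,y\<^sub>n]\<close> one has \<open>'m = 'n\<close>. For \<open>k[x\<^sub>0,\<dots>,x\<^sub>n,y\<^sub>0,\<dots>,y\<^sub>n\<^sub>+\<^sub>1]\<close> one has
  \<open>'m = 'n option\<close>, where \<open>None\<close> is the index \<open>n + 1\<close>.
\<close>

type_synonym ('n, 'm, 'k) bipoly = "('n + 'm, 'k) mpoly"

abbreviation X :: "'n \<Rightarrow> ('n, 'm, 'k::zero_neq_one) bipoly" where
  "X i \<equiv> Var (Inl i)"

abbreviation Y :: "'m \<Rightarrow> ('n, 'm, 'k::zero_neq_one) bipoly" where
  "Y j \<equiv> Var (Inr j)"

abbreviation in_x :: "('n::finite, 'k::comm_semiring_1) mpoly \<Rightarrow> ('n, 'm, 'k) bipoly" where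
  "in_x \<equiv> rename Inl"

abbreviation in_y :: "('m::finite, 'k::comm_semiring_1) mpoly \<Rightarrow> ('n, 'm, 'k) bipoly" where
  "in_y \<equiv> rename Inr"

text \<open>The inclusion of \<open>k[x, y]\<close> into \<open>k[x, y, y\<^sub>n\<^sub>+\<^sub>1]\<close>.\<close>

abbreviation extend ::
    "('n::finite, 'm::finite, 'k::comm_semiring_1) bipoly \<Rightarrow> ('n, 'm option, 'k) bipoly" where
  "extend \<equiv> rename (map_sum id Some)"

definition rees_map ::
    "('m \<Rightarrow> ('n, 'k::comm_ring_1) mpoly) \<Rightarrow> ('n::finite, 'm::finite, 'k) bipoly \<Rightarrow> ('n, 'k) mpoly poly" where
  "rees_map a = subst (\<lambda>c. [:Const c:]) (case_sum (\<lambda>i. [:Var i:]) (\<lambda>j. [:0, a j:]))"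

definition rees_ideal ::
    "('m \<Rightarrow> ('n, 'k::comm_ring_1) mpoly) \<Rightarrow> ('n::finite, 'm::finite, 'k) bipoly set" where
  "rees_ideal a = {P. rees_map a P = 0}"

text \<open>The generators \<open>f g\<^sub>0, \<dots>, f g\<^sub>n, g\<close> of the ideal \<open>(I f, g)\<close>.\<close>

definition J_gens ::
    "('n, 'k::comm_ring_1) mpoly \<Rightarrow> ('n \<Rightarrow> ('n, 'k) mpoly) \<Rightarrow> ('n, 'k) mpoly
      \<Rightarrow> 'n option \<Rightarrow> ('n, 'k) mpoly" where
  "J_gens f G g = case_option g (\<lambda>i. f * G i)"


section \<open>Biforms of syzygies and downgrading\<close>

text \<open>
  The notion is meant for generators \<open>a\<close> of one common degree; then the coordinates of a
  homogeneous syzygy also have one common degree.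
\<close>

definition homogeneous_syzygy ::
    "('m::finite \<Rightarrow> ('n::finite, 'k::comm_ring_1) mpoly) \<Rightarrow> ('m \<Rightarrow> ('n, 'k) mpoly) \<Rightarrow> bool" where
  "homogeneous_syzygy a s \<longleftrightarrow>
     (\<Sum>j\<in>UNIV. s j * a j) = 0 \<and> (\<exists>\<delta>. \<forall>j. homogeneous \<delta> (s j))"

definition biform ::
    "('m::finite \<Rightarrow> ('n::finite, 'k::comm_ring_1) mpoly) \<Rightarrow> ('n, 'm, 'k) bipoly" where
  "biform s = (\<Sum>j\<in>UNIV. in_x (s j) * Y j)"

definition syzygy_biforms ::
    "('m::finite option \<Rightarrow> ('n::finite, 'k::comm_ring_1) mpoly) \<Rightarrow> ('n, 'm option, 'k) bipoly set" where
  "syzygy_biforms a = {biform s |s. homogeneous_syzygy a s \<and> s None \<noteq> 0}"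

definition bihomogeneous :: "nat \<Rightarrow> nat \<Rightarrow> ('n::finite, 'm::finite, 'k::zero) bipoly \<Rightarrow> bool" where
  "bihomogeneous p q P \<longleftrightarrow>
     (\<forall>m\<in>Poly_Mapping.keys P.
        (\<Sum>i\<in>UNIV. Poly_Mapping.lookup m (Inl i)) = p \<and>
        (\<Sum>j\<in>UNIV. Poly_Mapping.lookup m (Inr j)) = q)"

definition deg_x :: "('n::finite, 'm, 'k::zero) bipoly \<Rightarrow> nat" where
  "deg_x P =
     Max (insert 0 ((\<lambda>m. \<Sum>i\<in>UNIV. Poly_Mapping.lookup m (Inl i)) ` Poly_Mapping.keys P))"

text \<open>
  \<open>downgraded H Q Q'\<close>: for some \<open>x\<close>-framing \<open>c r = (\<Sum>i. x\<^sub>i * F r i)\<close> of the coefficients \<open>c r\<close> of \<open>Q\<close>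
  as a polynomial in \<open>y\<^sub>n\<^sub>+\<^sub>1\<close>, the polynomial \<open>Q'\<close> is the resulting downgraded polynomial.
  If \<open>Q\<close> has bidegree \<open>(p + 1, q)\<close> then \<open>c r\<close> has bidegree \<open>(p + 1, q - r)\<close> and vanishes for \<open>r > q\<close>,
  and \<open>F r i\<close> has bidegree \<open>(p, q - r)\<close>. As \<open>c r\<close> and \<open>F r i\<close> are taken from the ring without
  \<open>y\<^sub>n\<^sub>+\<^sub>1\<close>, the \<open>c r\<close> are determined by \<open>Q\<close>.
\<close>

definition downgraded ::
    "('n \<Rightarrow> ('n, 'k::comm_ring_1) mpoly) \<Rightarrow> ('n::finite, 'n option, 'k) bipoly
      \<Rightarrow> ('n, 'n option, 'k) bipoly \<Rightarrow> bool" where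
  "downgraded H Q Q' \<longleftrightarrow>
     (\<exists>p q (c :: nat \<Rightarrow> ('n, 'n, 'k) bipoly) (F :: nat \<Rightarrow> 'n \<Rightarrow> ('n, 'n, 'k) bipoly).
        bihomogeneous (p + 1) q Q \<and>
        Q = (\<Sum>r\<le>q. extend (c r) * Y None ^ r) \<and>
        (\<forall>r\<le>q. c r = (\<Sum>i\<in>UNIV. X i * F r i) \<and> (\<forall>i. bihomogeneous p (q - r) (F r i))) \<and>
        Q' = (\<Sum>r\<le>q. extend (\<Sum>i\<in>UNIV. in_y (H i) * F r i) * Y None ^ r))"

text \<open>
  \<open>D\<close> is a sequence of iterated downgrades of \<open>Q\<close>, with an arbitrary framing chosen at every step.
  Each step lowers the \<open>x\<close>-degree by one, so there are \<open>deg_x Q\<close> steps.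
\<close>

definition downgrade_iterates ::
    "('n \<Rightarrow> ('n, 'k::comm_ring_1) mpoly) \<Rightarrow> ('n::finite, 'n option, 'k) bipoly
      \<Rightarrow> (nat \<Rightarrow> ('n, 'n option, 'k) bipoly) \<Rightarrow> bool" where
  "downgrade_iterates H Q D \<longleftrightarrow>
     D 0 = Q \<and> (\<forall>l < deg_x Q. downgraded H (D l) (D (Suc l)))"

end

theory Submission
  imports Defs
begin

text \<open>
  Write \<open>R = k[x]\<close>, \<open>\<rho>\<close> for the map \<open>R[y, y\<^sub>n\<^sub>+\<^sub>1] \<rightarrow> R[t]\<close> that sends \<open>y\<^sub>i\<close> to \<open>f g\<^sub>i t\<close> and
  \<open>y\<^sub>n\<^sub>+\<^sub>1\<close> to \<open>g t\<close>, and \<open>\<J>\<close> for its kernel, the defining ideal of the Rees algebra of \<open>J\<close>.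
  It is prime because \<open>R[t]\<close> is a domain.

  The ideal \<open>\<DD>\<close> lies in \<open>\<J>\<close>. On polynomials without \<open>y\<^sub>n\<^sub>+\<^sub>1\<close>, \<open>\<rho>\<close> is the corresponding map for \<open>I\<close>
  followed by the injective substitution \<open>t \<mapsto> f t\<close>; hence \<open>\<J> \<inter> k[x, y] = \<I>\<close>
  (\<open>extend_in_rees_ideal_iff\<close>). Biforms of syzygies vanish under \<open>\<rho>\<close> by definition. Downgrading
  replaces each \<open>x\<^sub>i\<close> of a framing by \<open>g'\<^sub>i(y)\<close>, and as \<open>\<GG>\<close> and \<open>g'\<close> are inverse to each other, the
  images \<open>\<rho>(g'\<^sub>i(y))\<close> are proportional to the \<open>x\<^sub>i\<close>; so, up to a nonzero factor, \<open>\<rho>(D(Q))\<close> is a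
  multiple of \<open>\<rho>(Q)\<close>, whatever framing is taken (\<open>rees_map_downgraded\<close>).

  For minimality, think of \<open>\<J>\<close> as a prime of \<open>B[y\<^sub>n\<^sub>+\<^sub>1]\<close>, where \<open>B = k[x, y]/\<I>\<close> is a domain. It
  contracts to zero in \<open>B\<close>, so it has height at most one, and a prime between \<open>\<DD>\<close> and \<open>\<J>\<close> must be \<open>\<J>\<close>
  as soon as it contains a polynomial that is nonzero over \<open>B\<close>. The biform \<open>Q\<close> of a syzygy with last
  coordinate \<open>s \<noteq> 0\<close> is one, and since it is linear in \<open>y\<^sub>n\<^sub>+\<^sub>1\<close>, dimension theory can be replaced by
  division: modulo \<open>Q\<close>, a power of \<open>s\<close> times any \<open>F\<close> is free of \<open>y\<^sub>n\<^sub>+\<^sub>1\<close> (\<open>eliminate_last_variable\<close>).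
  If \<open>F \<in> \<J>\<close>, the remainder is in \<open>\<J> \<inter> k[x, y] = \<I>\<close>, so \<open>s\<^sup>N F\<close> lies in the smaller prime, and
  \<open>s \<notin> \<J>\<close> can be cancelled (\<open>prime_between_is_rees_ideal\<close>).
\<close>

section \<open>The universal property of the polynomial ring\<close>

locale semiring_hom =
  fixes h :: "'a::comm_semiring_1 \<Rightarrow> 'b::comm_semiring_1"
  assumes zero: "h 0 = 0" and one: "h 1 = 1"
    and add: "h (a + b) = h a + h b" and mult: "h (a * b) = h a * h b"
begin

lemma sum: "h (\<Sum>i\<in>A. F i) = (\<Sum>i\<in>A. h (F i))"
  by (induction A rule: infinite_finite_induct) (simp_all add: zero add)

lemma prod: "h (\<Prod>i\<in>A. F i) = (\<Prod>i\<in>A. h (F i))"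
  by (induction A rule: infinite_finite_induct) (simp_all add: one mult)

lemma power: "h (a ^ n) = h a ^ n"
  by (induction n) (simp_all add: one mult)

end

lemma semiring_hom_comp:
  assumes "semiring_hom h" and "semiring_hom h'"
  shows "semiring_hom (\<lambda>a. h (h' a))"
  using assms by (simp add: semiring_hom_def)

lemma semiring_hom_Const: "semiring_hom (Const :: 'k::comm_semiring_1 \<Rightarrow> ('v, 'k) mpoly)"
  by unfold_locales (simp_all add: Const_def single_add mult_single)

lemma semiring_hom_constant_poly: "semiring_hom (\<lambda>a::'a::comm_semiring_1. [:a:])"
  by unfold_locales (simp_all add: one_pCons, simp only: mult.commute)

lemma semiring_hom_pcompose:
  "semiring_hom (\<lambda>p::'a::comm_ring_1 poly. pcompose p q)"
  by unfold_locales (simp_all add: pcompose_1 pcompose_add pcompose_mult)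

lemma mpoly_eq_sum_single:
  "p = (\<Sum>m\<in>Poly_Mapping.keys p. Poly_Mapping.single m (Poly_Mapping.lookup p m))"
proof (rule poly_mapping_eqI)
  fix k
  show "Poly_Mapping.lookup p k =
    Poly_Mapping.lookup (\<Sum>m\<in>Poly_Mapping.keys p. Poly_Mapping.single m (Poly_Mapping.lookup p m)) k"
    by (simp add: lookup_sum lookup_single when_def in_keys_iff sum.delta)
qed

lemma mpoly_single_induct [case_names single add]:
  fixes p :: "('v, 'k::comm_monoid_add) mpoly"
  assumes single: "\<And>m a. P (Poly_Mapping.single m a)"
    and add: "\<And>p q. P p \<Longrightarrow> P q \<Longrightarrow> P (p + q)"
  shows "P p"
proof -
  have "P (\<Sum>m\<in>A. Poly_Mapping.single m (Poly_Mapping.lookup p m))" if "finite A" for A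
    using that
  proof induction
    case empty
    show ?case using single[of 0 0] by simp
  next
    case (insert m A)
    then show ?case by (simp add: add single)
  qed
  then show ?thesis by (subst mpoly_eq_sum_single) simp
qed

text \<open>
  Stated for an arbitrary map \<open>\<phi>\<close> of the variables: the identity recovers a monomial from its
  variables, and an injection into the naturals computes the effect of renaming.
\<close>

lemma prod_Var_power:
  "(\<Prod>v\<in>A. Var (\<phi> v) ^ e v :: ('w, 'k::comm_semiring_1) mpoly) =
    Poly_Mapping.single (\<Sum>v\<in>A. Poly_Mapping.single (\<phi> v) (e v)) 1"
proof -
  have Var_power: "(Var w :: ('w, 'k) mpoly) ^ n = Poly_Mapping.single (Poly_Mapping.single w n) 1"
    for w n
    by (induction n) (simp_all add: Var_def mult_single single_add[symmetric])
  show ?thesis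
    by (induction A rule: infinite_finite_induct) (simp_all add: Var_power mult_single)
qed

lemma mpoly_induct [case_names Const Var add mult]:
  fixes p :: "('v::finite, 'k::comm_semiring_1) mpoly"
  assumes Const: "\<And>c. P (Const c)" and Var: "\<And>v. P (Var v)"
    and add: "\<And>p q. P p \<Longrightarrow> P q \<Longrightarrow> P (p + q)" and mult: "\<And>p q. P p \<Longrightarrow> P q \<Longrightarrow> P (p * q)"
  shows "P p"
proof (induction p rule: mpoly_single_induct)
  case (single m a)
  have one: "P 1" using Const[of 1] by (simp add: Const_def)
  have power: "P (Var v ^ n)" for v n
    by (induction n) (simp_all add: one mult Var)
  have "P (\<Prod>v\<in>A. Var v ^ Poly_Mapping.lookup m v)" for A
    by (induction A rule: infinite_finite_induct) (simp_all add: one mult power)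
  then have "P (Const a * (\<Prod>v\<in>UNIV. Var v ^ Poly_Mapping.lookup m v))"
    by (intro mult Const)
  moreover have "(\<Sum>v\<in>UNIV. Poly_Mapping.single v (Poly_Mapping.lookup m v)) = m"
    by (rule poly_mapping_eqI) (simp add: lookup_sum lookup_single when_def)
  ultimately show ?case
    by (simp add: prod_Var_power[of "\<lambda>v. v"] Const_def mult_single)
next
  case (add p q)
  then show ?case by (rule assms(3))
qed

lemma mpoly_hom_eqI:
  fixes p :: "('v::finite, 'k::comm_semiring_1) mpoly"
  assumes "semiring_hom h" and "semiring_hom h'"
    and "\<And>c. h (Const c) = h' (Const c)" and "\<And>v. h (Var v) = h' (Var v)"
  shows "h p = h' p"
  using assms
  by (induction p rule: mpoly_induct) (simp_all add: semiring_hom.add semiring_hom.mult)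

context semiring_hom
begin

lemma subst_single:
  "subst h u (Poly_Mapping.single m a) = h a * (\<Prod>v\<in>UNIV. u v ^ Poly_Mapping.lookup m v)"
  by (cases "a = 0") (simp_all add: subst_def zero)

lemma subst_add: "subst h u (p + q) = subst h u p + subst h u q"
proof -
  let ?t = "\<lambda>p m. h (Poly_Mapping.lookup p m) * (\<Prod>v\<in>UNIV. u v ^ Poly_Mapping.lookup m v)"
  let ?K = "Poly_Mapping.keys p \<union> Poly_Mapping.keys q"
  have over_K: "subst h u r = (\<Sum>m\<in>?K. ?t r m)" if "Poly_Mapping.keys r \<subseteq> ?K" for r
    unfolding subst_def using that
    by (intro sum.mono_neutral_left) (auto simp: in_keys_iff zero)
  show ?thesis
    using keys_add[of p q]
    by (simp add: over_K lookup_add add distrib_right sum.distrib)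
qed

lemma subst_mult: "subst h u (p * q) = subst h u p * subst h u q"
proof (induction p rule: mpoly_single_induct)
  case (single m a)
  show ?case
  proof (induction q rule: mpoly_single_induct)
    case (single m' b)
    show ?case
      by (simp add: mult_single subst_single mult lookup_add power_add prod.distrib ac_simps)
  next
    case (add p q)
    then show ?case by (simp add: distrib_left subst_add)
  qed
next
  case (add p q)
  then show ?case by (simp add: distrib_right subst_add)
qed

lemma subst_Const: "subst h u (Const a) = h a"
  by (simp add: Const_def subst_single)

lemma subst_Var: "subst h u (Var v) = u v"
proof -
  have "(\<Prod>w\<in>UNIV. u w ^ Poly_Mapping.lookup (Poly_Mapping.single v 1) w) =
      (\<Prod>w\<in>UNIV. if w = v then u w else 1)"
    by (intro prod.cong) (auto simp: lookup_single when_def)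
  then show ?thesis by (simp add: Var_def subst_single one)
qed

lemma semiring_hom_subst: "semiring_hom (subst h u)"
proof
  show "subst h u 0 = 0" by (simp add: subst_def)
  show "subst h u 1 = 1" using subst_Const[of u 1] by (simp add: Const_def one)
qed (simp_all add: subst_add subst_mult)

end

interpretation rename: semiring_hom "rename \<phi> :: ('v::finite, 'k::comm_semiring_1) mpoly \<Rightarrow> ('w, 'k) mpoly"
  for \<phi>
  unfolding rename_def by (rule semiring_hom.semiring_hom_subst[OF semiring_hom_Const])

lemma rename_Const: "rename \<phi> (Const c) = Const c"
  and rename_Var: "rename \<phi> (Var v) = Var (\<phi> v)"
  unfolding rename_def
  by (simp_all add: semiring_hom.subst_Const semiring_hom.subst_Var semiring_hom_Const)


section \<open>Absence of zero divisors\<close>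

text \<open>
  An injective renaming carries distinct exponent vectors to distinct exponent vectors, so
  no two terms of the image can cancel.
\<close>

lemma rename_eq_0_imp_eq_0:
  fixes p :: "('v::finite, 'k::comm_semiring_1) mpoly"
  assumes "inj \<phi>" and "rename \<phi> p = 0"
  shows "p = 0"
proof -
  \<comment> \<open>The action of the renaming on exponent vectors.\<close>
  define push where "push m = (\<Sum>v\<in>UNIV. Poly_Mapping.single (\<phi> v) (Poly_Mapping.lookup m v))"
    for m :: "'v \<Rightarrow>\<^sub>0 nat"
  have "Poly_Mapping.lookup (push m) (\<phi> v) = Poly_Mapping.lookup m v" for m v
    using \<open>inj \<phi>\<close> by (simp add: push_def lookup_sum lookup_single when_def inj_eq)
  then have push_eq_iff: "push m = push m' \<longleftrightarrow> m = m'" for m m'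
    by (metis poly_mapping_eqI)
  have "Poly_Mapping.lookup (rename \<phi> p) (push m) = Poly_Mapping.lookup p m" for m
  proof (induction p rule: mpoly_single_induct)
    case (single k a)
    have "rename \<phi> (Poly_Mapping.single k a) = Poly_Mapping.single (push k) a"
      by (simp add: rename_def semiring_hom.subst_single[OF semiring_hom_Const] prod_Var_power
        push_def Const_def mult_single)
    then show ?case by (simp add: lookup_single when_def push_eq_iff)
  qed (simp add: rename.add lookup_add)
  then show ?thesis using assms(2) by (metis lookup_zero poly_mapping_eqI)
qed

text \<open>
  The argument with leading terms needs a monomial order, hence an order on the variables, and
  an arbitrary finite index type has none. Numbering the variables embeds the ring into the
  polynomials in variables indexed by the naturals, which form a domain.
\<close>

lemma mpoly_no_zero_divisors:
  fixes p q :: "('v::finite, 'k::idom) mpoly"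
  assumes "p * q = 0"
  shows "p = 0 \<or> q = 0"
proof -
  obtain \<iota> :: "'v \<Rightarrow> nat" where \<iota>: "inj \<iota>"
    using finite_imp_inj_to_nat_seg[of "UNIV :: 'v set"] by auto
  have "rename \<iota> p * rename \<iota> q = 0"
    using assms by (simp flip: rename.mult add: rename.zero)
  then show ?thesis
    using rename_eq_0_imp_eq_0[OF \<iota>] by auto
qed

text \<open>
  The coefficient ring is not an instance of \<^class>\<open>idom\<close> for unordered variables, so the instance for
  univariate polynomials does not apply and the leading coefficients are compared directly.
\<close>

lemma poly_mpoly_no_zero_divisors:
  fixes p q :: "('v::finite, 'k::idom) mpoly poly"
  assumes "p * q = 0"
  shows "p = 0 \<or> q = 0"
proof -
  have "coeff p (degree p) * coeff q (degree q) = 0"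
    using assms by (simp flip: coeff_mult_degree_sum)
  then show ?thesis
    using mpoly_no_zero_divisors leading_coeff_0_iff by metis
qed

lemma mpoly_power_eq_0D:
  fixes p :: "('v::finite, 'k::idom) mpoly"
  assumes "p ^ n = 0"
  shows "p = 0"
  using assms by (induction n) (auto dest: mpoly_no_zero_divisors)

lemma Var_neq_0: "Var v \<noteq> (0 :: ('v, 'k::zero_neq_one) mpoly)"
  by (metis Var_def lookup_single_eq lookup_zero zero_neq_one)


section \<open>Ideals\<close>

lemma module_mult: "module ((*) :: 'a::comm_ring_1 \<Rightarrow> 'a \<Rightarrow> 'a)"
  by unfold_locales (simp_all add: algebra_simps)

lemma is_ideal_iff:
  "is_ideal I \<longleftrightarrow> 0 \<in> I \<and> (\<forall>a\<in>I. \<forall>b\<in>I. a + b \<in> I) \<and> (\<forall>c. \<forall>a\<in>I. c * a \<in> I)"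
  unfolding is_ideal_def by (rule module.subspace_def[OF module_mult])

lemma is_idealD:
  assumes "is_ideal I"
  shows "0 \<in> I" and "a \<in> I \<Longrightarrow> b \<in> I \<Longrightarrow> a + b \<in> I" and "a \<in> I \<Longrightarrow> c * a \<in> I"
  using assms by (simp_all add: is_ideal_iff)

lemma ideal_of_least: "A \<subseteq> I \<Longrightarrow> is_ideal I \<Longrightarrow> ideal_of A \<subseteq> I"
  unfolding is_ideal_def ideal_of_def by (rule module.span_minimal[OF module_mult])

lemma subset_ideal_of: "A \<subseteq> ideal_of A"
  unfolding ideal_of_def by (rule module.span_superset[OF module_mult])

lemma prime_ideal_powerD:
  assumes "prime_ideal P" and "a ^ n \<in> P"
  shows "a \<in> P"
  using assms(2)
proof (induction n)
  case 0
  then have "c \<in> P" for c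
    using is_idealD(3)[of P 1 c] assms(1) by (simp add: prime_ideal_def)
  then show ?case .
next
  case (Suc n)
  then show ?case using assms(1) by (auto simp: prime_ideal_def)
qed


section \<open>Rees ideals\<close>

interpretation rees_map: semiring_hom
  "rees_map a :: ('n::finite, 'm::finite, 'k::comm_ring_1) bipoly \<Rightarrow> _" for a
  unfolding rees_map_def
  by (intro semiring_hom.semiring_hom_subst semiring_hom_comp[OF semiring_hom_constant_poly semiring_hom_Const])

lemma rees_map_Const: "rees_map a (Const c) = [:Const c:]"
  and rees_map_X: "rees_map a (X i) = [:Var i:]"
  and rees_map_Y: "rees_map a (Y j) = [:0, a j:]"
  unfolding rees_map_def
  by (simp_all add: semiring_hom.subst_Const semiring_hom.subst_Var
    semiring_hom_comp[OF semiring_hom_constant_poly semiring_hom_Const])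

lemma extend_in_x: "extend (in_x p) = in_x p"
  by (rule mpoly_hom_eqI[OF semiring_hom_comp[OF rename.semiring_hom_axioms rename.semiring_hom_axioms]
      rename.semiring_hom_axioms]) (simp_all add: rename_Const rename_Var)

lemma rees_map_in_x: "rees_map a (in_x s) = [:s:]"
  by (rule mpoly_hom_eqI[OF semiring_hom_comp[OF rees_map.semiring_hom_axioms rename.semiring_hom_axioms]
      semiring_hom_constant_poly])
    (simp_all add: rename_Const rename_Var rees_map_Const rees_map_X)

text \<open>
  Each variable \<open>y\<^sub>j\<close> contributes one factor \<open>t\<close>, so a form of degree \<open>e\<close> in \<open>y\<close> goes to a multiple of
  \<open>t\<^sup>e\<close>; with inverse maps in place of \<open>h\<close> and \<open>a\<close>, its coefficient is a coordinate of their composite.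
\<close>

lemma rees_map_in_y_homogeneous:
  fixes a :: "'m::finite \<Rightarrow> ('n::finite, 'k::comm_ring_1) mpoly"
  assumes "homogeneous e h"
  shows "rees_map a (in_y h) = monom (subst Const a h) e"
proof -
  interpret C: semiring_hom "\<lambda>c. [:Const c:] :: ('n, 'k) mpoly poly"
    by (rule semiring_hom_comp[OF semiring_hom_constant_poly semiring_hom_Const])
  have prod_monom: "(\<Prod>v\<in>A. [:0, a v:] ^ l v) = monom (\<Prod>v\<in>A. a v ^ l v) (\<Sum>v\<in>A. l v)" for A l
  proof -
    have "[:0, a v:] ^ n = monom (a v ^ n) n" for v n
      using monom_power[of "a v" 1 n] by (simp add: monom_Suc monom_0)
    then show ?thesis
      by (induction A rule: infinite_finite_induct) (simp_all add: mult_monom)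
  qed
  have "rees_map a (in_y h) = subst (\<lambda>c. [:Const c:]) (\<lambda>j. [:0, a j:]) h"
    by (rule mpoly_hom_eqI[OF semiring_hom_comp[OF rees_map.semiring_hom_axioms rename.semiring_hom_axioms]
        C.semiring_hom_subst])
      (simp_all add: rename_Const rename_Var rees_map_Const rees_map_Y C.subst_Const C.subst_Var)
  also have "\<dots> = (\<Sum>m\<in>Poly_Mapping.keys h.
      monom (Const (Poly_Mapping.lookup h m) * (\<Prod>v\<in>UNIV. a v ^ Poly_Mapping.lookup m v)) e)"
    unfolding subst_def using assms
    by (intro sum.cong) (auto simp: homogeneous_def prod_monom smult_monom)
  also have "\<dots> = monom (subst Const a h) e"
    by (simp add: subst_def monom_sum)
  finally show ?thesis .
qed

text \<open>
  Without \<open>y\<^sub>n\<^sub>+\<^sub>1\<close>, the generators \<open>f g\<^sub>i\<close> differ from \<open>g\<^sub>i\<close> only by the factor \<open>f\<close>, which can be moved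
  to the variable \<open>t\<close>.
\<close>

lemma rees_map_J_gens_extend:
  "rees_map (J_gens f G g) (extend p) = pcompose (rees_map G p) [:0, f:]"
proof (rule mpoly_hom_eqI[OF semiring_hom_comp[OF rees_map.semiring_hom_axioms rename.semiring_hom_axioms]
      semiring_hom_comp[OF semiring_hom_pcompose rees_map.semiring_hom_axioms]])
  fix v
  show "rees_map (J_gens f G g) (extend (Var v)) = pcompose (rees_map G (Var v)) [:0, f:]"
    by (cases v) (simp_all add: rename_Var rees_map_X rees_map_Y J_gens_def pcompose_pCons)
qed (simp add: rename_Const rees_map_Const)

text \<open>
  The substitution \<open>t \<mapsto> f t\<close> multiplies the coefficient of \<open>t\<^sup>n\<close> by \<open>f\<^sup>n \<noteq> 0\<close>, so it is injective.
\<close>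

lemma extend_in_rees_ideal_iff:
  fixes f :: "('n::finite, 'k::idom) mpoly"
  assumes "f \<noteq> 0"
  shows "extend p \<in> rees_ideal (J_gens f G g) \<longleftrightarrow> p \<in> rees_ideal G"
proof -
  have "pcompose q [:0, f:] = 0 \<longleftrightarrow> q = 0" for q
  proof
    assume "pcompose q [:0, f:] = 0"
    then have "f ^ n * coeff q n = 0" for n
      by (metis coeff_pcompose_linear coeff_0)
    then have "coeff q n = 0" for n
      using mpoly_no_zero_divisors mpoly_power_eq_0D assms by blast
    then show "q = 0" by (simp add: poly_eq_iff)
  qed simp
  then show ?thesis by (simp add: rees_ideal_def rees_map_J_gens_extend)
qed

lemma prime_ideal_rees_ideal:
  fixes a :: "'m::finite \<Rightarrow> ('n::finite, 'k::idom) mpoly"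
  shows "prime_ideal (rees_ideal a)"
proof -
  have "1 \<notin> rees_ideal a" by (simp add: rees_ideal_def rees_map.one)
  moreover have "is_ideal (rees_ideal a)"
    by (simp add: is_ideal_iff rees_ideal_def rees_map.zero rees_map.add rees_map.mult)
  ultimately show ?thesis
    by (auto simp: prime_ideal_def rees_ideal_def rees_map.mult dest: poly_mpoly_no_zero_divisors)
qed


section \<open>Biforms and downgrading\<close>

lemma biform_in_rees_ideal:
  assumes "homogeneous_syzygy a s"
  shows "biform s \<in> rees_ideal a"
proof -
  have "rees_map a (biform s) = (\<Sum>j\<in>UNIV. [:0, s j * a j:])"
    by (simp add: biform_def rees_map.sum rees_map.mult rees_map_in_x rees_map_Y mult.commute[of "s _"])
  also have "\<dots> = [:0, \<Sum>j\<in>UNIV. s j * a j:]"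
    by (rule poly_eqI) (simp add: coeff_sum coeff_pCons split: nat.split)
  finally show ?thesis
    using assms by (simp add: rees_ideal_def homogeneous_syzygy_def)
qed

text \<open>
  The image of the downgraded polynomial is a sum with factors \<open>H\<^sub>i(f t G)\<close>. Multiplying by \<open>x\<^sub>j\<close> turns
  them into \<open>x\<^sub>i H\<^sub>j(f t G)\<close>, because \<open>x\<^sub>j H\<^sub>i(G) = x\<^sub>i H\<^sub>j(G)\<close>. The common factor \<open>H\<^sub>j(f t G)\<close> comes out
  of the sum, and the framing reassembles the original polynomial.
\<close>

lemma rees_map_downgraded:
  fixes G :: "'n::finite \<Rightarrow> ('n, 'k::idom) mpoly"
  assumes "\<forall>i. homogeneous d (H i)" and "same_rational_map (composite H G) Var"
    and "downgraded H Q Q'"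
  shows "[:Var j:] * rees_map (J_gens f G g) Q' =
    pcompose (rees_map G (in_y (H j))) [:0, f:] * rees_map (J_gens f G g) Q"
proof -
  let ?\<rho> = "rees_map (J_gens f G g)"
  let ?h = "\<lambda>i. pcompose (rees_map G (in_y (H i))) [:0, f:]"
  obtain q c F where
    Q: "Q = (\<Sum>r\<le>q. extend (c r) * Y None ^ r)" and
    c: "\<And>r. r \<le> q \<Longrightarrow> c r = (\<Sum>i\<in>UNIV. X i * F r i)" and
    Q': "Q' = (\<Sum>r\<le>q. extend (\<Sum>i\<in>UNIV. in_y (H i) * F r i) * Y None ^ r)"
    using assms(3) unfolding downgraded_def by blast
  have minors: "[:Var j:] * ?h i = [:Var i:] * ?h j" for i
  proof -
    have "Var j * composite H G i = Var i * composite H G j"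
      using assms(2) by (auto simp: same_rational_map_def mult.commute)
    then have "monom (Var j * subst Const G (H i)) d = monom (Var i * subst Const G (H j)) d"
      by (simp only: composite_def)
    then have "[:Var j:] * rees_map G (in_y (H i)) = [:Var i:] * rees_map G (in_y (H j))"
      by (simp add: rees_map_in_y_homogeneous[OF assms(1)[rule_format]] smult_monom)
    then have "pcompose ([:Var j:] * rees_map G (in_y (H i))) [:0, f:] =
        pcompose ([:Var i:] * rees_map G (in_y (H j))) [:0, f:]"
      by (rule arg_cong)
    then show ?thesis
      by (simp only: pcompose_mult pcompose_const)
  qed
  have "[:Var j:] * ?\<rho> (extend (\<Sum>i\<in>UNIV. in_y (H i) * F r i)) = ?h j * ?\<rho> (extend (c r))"
    if "r \<le> q" for r
  proof -
    have "[:Var j:] * ?\<rho> (extend (\<Sum>i\<in>UNIV. in_y (H i) * F r i)) =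
        (\<Sum>i\<in>UNIV. ([:Var j:] * ?h i) * ?\<rho> (extend (F r i)))"
      by (simp only: rename.sum rename.mult rees_map.sum rees_map.mult rees_map_J_gens_extend
        sum_distrib_left mult.assoc)
    also have "\<dots> = (\<Sum>i\<in>UNIV. ?h j * ([:Var i:] * ?\<rho> (extend (F r i))))"
      by (simp only: minors) (simp only: ac_simps)
    also have "\<dots> = ?h j * ?\<rho> (extend (c r))"
      by (simp only: c[OF that] rename.sum rename.mult rees_map.sum rees_map.mult rename_Var
        map_sum.simps id_apply rees_map_X sum_distrib_left)
    finally show ?thesis .
  qed
  then show ?thesis
    unfolding Q Q' rees_map.sum rees_map.mult sum_distrib_left
    by (intro sum.cong refl) (simp only: atMost_iff mult.assoc[symmetric])
qed

lemma downgraded_in_rees_ideal: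
  fixes G :: "'n::finite \<Rightarrow> ('n, 'k::idom) mpoly"
  assumes "\<forall>i. homogeneous d (H i)" and "same_rational_map (composite H G) Var"
    and "downgraded H Q Q'" and "Q \<in> rees_ideal (J_gens f G g)"
  shows "Q' \<in> rees_ideal (J_gens f G g)"
proof -
  have "[:Var undefined:] * rees_map (J_gens f G g) Q' = 0"
    using rees_map_downgraded[OF assms(1-3)] assms(4) by (simp add: rees_ideal_def)
  then show ?thesis
    using poly_mpoly_no_zero_divisors[of "[:Var undefined:]"] by (auto simp: rees_ideal_def Var_neq_0)
qed

lemma downgrade_iterates_in_rees_ideal:
  fixes G :: "'n::finite \<Rightarrow> ('n, 'k::idom) mpoly"
  assumes "\<forall>i. homogeneous d (H i)" and "same_rational_map (composite H G) Var"
    and "downgrade_iterates H Q D" and "Q \<in> rees_ideal (J_gens f G g)" and "l \<le> deg_x Q"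
  shows "D l \<in> rees_ideal (J_gens f G g)"
  using \<open>l \<le> deg_x Q\<close>
proof (induction l)
  case 0
  then show ?case using assms(3,4) by (simp add: downgrade_iterates_def)
next
  case (Suc l)
  then have "downgraded H (D l) (D (Suc l))" and "D l \<in> rees_ideal (J_gens f G g)"
    using assms(3) by (simp_all add: downgrade_iterates_def)
  then show ?case by (rule downgraded_in_rees_ideal[OF assms(1,2)])
qed


section \<open>Minimality\<close>

text \<open>
  The Koszul relation between \<open>f g\<^sub>i\<close> and \<open>g\<close>.
\<close>

lemma ex_syzygy_last_neq_0:
  fixes G :: "'n::finite \<Rightarrow> ('n, 'k::idom) mpoly"
  assumes "\<forall>i. homogeneous d (G i)" and "homogeneous e f" and "homogeneous (d + e) g"
    and "f \<noteq> 0" and "G i \<noteq> 0"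
  shows "\<exists>s. homogeneous_syzygy (J_gens f G g) s \<and> s None \<noteq> 0"
proof (intro exI conjI)
  let ?s = "\<lambda>j. case j of None \<Rightarrow> - (f * G i) | Some j \<Rightarrow> if j = i then g else 0"
  have "homogeneous (d + e) (f * G i)"
    unfolding homogeneous_def
  proof
    fix m assume "m \<in> Poly_Mapping.keys (f * G i)"
    then obtain a b where "m = a + b" "a \<in> Poly_Mapping.keys f" "b \<in> Poly_Mapping.keys (G i)"
      using keys_mult[of f "G i"] by blast
    then show "(\<Sum>v\<in>UNIV. Poly_Mapping.lookup m v) = d + e"
      using assms(1,2) by (simp add: homogeneous_def lookup_add sum.distrib)
  qed
  then have "homogeneous (d + e) (?s j)" for j
    using assms(3) by (auto simp: homogeneous_def split: option.split)
  moreover have "(\<Sum>j\<in>UNIV. ?s j * J_gens f G g j) = 0"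
  proof -
    have "(\<Sum>j\<in>UNIV. ?s j * J_gens f G g j) =
        - (f * G i) * g + (\<Sum>j\<in>UNIV. (if j = i then g else 0) * (f * G j))"
      by (simp add: UNIV_option_conv sum.reindex J_gens_def)
    also have "(\<Sum>j\<in>UNIV. (if j = i then g else 0) * (f * G j)) =
        (\<Sum>j\<in>UNIV. if j = i then g * (f * G j) else 0)"
      by (intro sum.cong) auto
    finally show ?thesis by (simp add: mult.commute)
  qed
  ultimately show "homogeneous_syzygy (J_gens f G g) ?s"
    unfolding homogeneous_syzygy_def by blast
  show "?s None \<noteq> 0"
    using assms(4,5) mpoly_no_zero_divisors by auto
qed

text \<open>
  Division by \<open>s\<^sub>n\<^sub>+\<^sub>1 y\<^sub>n\<^sub>+\<^sub>1 + \<Sum> s\<^sub>i y\<^sub>i\<close>: after multiplication by \<open>s\<^sub>n\<^sub>+\<^sub>1\<close> the variable \<open>y\<^sub>n\<^sub>+\<^sub>1\<close> can be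
  exchanged for \<open>- \<Sum> s\<^sub>i y\<^sub>i\<close>. The polynomials for which this succeeds form a subring.
\<close>

lemma eliminate_last_variable:
  fixes s :: "'n::finite option \<Rightarrow> ('n, 'k::comm_ring_1) mpoly"
  assumes "is_ideal I" and "biform s \<in> I"
  shows "\<exists>N r. in_x (s None) ^ N * F - extend r \<in> I"
proof (induction F rule: mpoly_induct)
  case (Const c)
  have "in_x (s None) ^ 0 * Const c - extend (Const c) \<in> I"
    by (simp add: rename_Const is_idealD[OF assms(1)])
  then show ?case by blast
next
  case (Var v)
  have old: "\<exists>N r. in_x (s None) ^ N * Var v - extend r \<in> I"
    if "Var v = extend r" for r :: "('n, 'n, 'k) bipoly"
  proof -
    have "in_x (s None) ^ 0 * Var v - extend r = 0"
      by (simp only: that power_0 mult_1 diff_self)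
    then have "in_x (s None) ^ 0 * Var v - extend r \<in> I"
      using is_idealD(1)[OF assms(1)] by (simp only:)
    then show ?thesis by blast
  qed
  consider i where "v = Inl i" | j where "v = Inr (Some j)" | "v = Inr None"
    by (metis sum.exhaust option.exhaust)
  then show ?case
  proof cases
    case (1 i)
    then have "Var v = extend (X i)" by (simp add: rename_Var)
    then show ?thesis by (rule old)
  next
    case (2 j)
    then have "Var v = extend (Y j)" by (simp add: rename_Var)
    then show ?thesis by (rule old)
  next
    case 3
    let ?r = "- (\<Sum>j\<in>UNIV. in_x (s (Some j)) * Y j)"
    have "extend ?r = - (\<Sum>j\<in>UNIV. in_x (s (Some j)) * Y (Some j))"
      using rename.add[of "map_sum id Some" ?r "- ?r"]
      by (simp add: rename.zero rename.sum rename.mult rename_Var extend_in_x eq_neg_iff_add_eq_0)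
    then have "in_x (s None) ^ 1 * Var v - extend ?r = biform s"
      by (simp add: 3 biform_def UNIV_option_conv sum.reindex)
    then have "in_x (s None) ^ 1 * Var v - extend ?r \<in> I"
      using assms(2) by simp
    then show ?thesis by blast
  qed
next
  case (add p q)
  then obtain N r M r' where
    "in_x (s None) ^ N * p - extend r \<in> I" "in_x (s None) ^ M * q - extend r' \<in> I"
    by blast
  then have "in_x (s None) ^ M * (in_x (s None) ^ N * p - extend r) +
      in_x (s None) ^ N * (in_x (s None) ^ M * q - extend r') \<in> I"
    by (intro is_idealD[OF assms(1)])
  also have "in_x (s None) ^ M * (in_x (s None) ^ N * p - extend r) +
      in_x (s None) ^ N * (in_x (s None) ^ M * q - extend r') =
      in_x (s None) ^ (N + M) * (p + q) - extend (in_x (s None) ^ M * r + in_x (s None) ^ N * r')"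
    by (simp only: rename.add rename.mult rename.power extend_in_x power_add) (simp only: algebra_simps)
  finally show ?case by blast
next
  case (mult p q)
  then obtain N r M r' where
    "in_x (s None) ^ N * p - extend r \<in> I" "in_x (s None) ^ M * q - extend r' \<in> I"
    by blast
  then have "(in_x (s None) ^ M * q) * (in_x (s None) ^ N * p - extend r) +
      extend r * (in_x (s None) ^ M * q - extend r') \<in> I"
    by (intro is_idealD[OF assms(1)])
  also have "(in_x (s None) ^ M * q) * (in_x (s None) ^ N * p - extend r) +
      extend r * (in_x (s None) ^ M * q - extend r') =
      in_x (s None) ^ (N + M) * (p * q) - extend (r * r')"
    by (simp only: rename.mult power_add) (simp add: algebra_simps)
  finally show ?case by blast
qed

text \<open>
  This plays the part of the height computation: the contraction of \<open>P\<close> to \<open>k[x, y]\<close> is as large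
  as that of the whole Rees ideal, and \<open>P\<close> contains a polynomial of degree one in \<open>y\<^sub>n\<^sub>+\<^sub>1\<close> whose
  leading coefficient lies outside the Rees ideal and can therefore be cancelled.
\<close>

lemma prime_between_is_rees_ideal:
  fixes G :: "'n::finite \<Rightarrow> ('n, 'k::idom) mpoly"
  assumes "f \<noteq> 0" and "homogeneous_syzygy (J_gens f G g) s" and "s None \<noteq> 0"
    and "prime_ideal P" and "extend ` rees_ideal G \<subseteq> P" and "biform s \<in> P"
    and "P \<subseteq> rees_ideal (J_gens f G g)"
  shows "P = rees_ideal (J_gens f G g)"
proof
  let ?J = "rees_ideal (J_gens f G g)"
  show "?J \<subseteq> P"
  proof
    fix F assume F: "F \<in> ?J"
    have P: "is_ideal P" and J: "is_ideal ?J"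
      using assms(4) prime_ideal_rees_ideal by (auto simp: prime_ideal_def)
    obtain N r where r: "in_x (s None) ^ N * F - extend r \<in> P"
      using eliminate_last_variable[OF P assms(6)] by blast
    have "extend r = in_x (s None) ^ N * F + (-1) * (in_x (s None) ^ N * F - extend r)"
      by simp
    also have "\<dots> \<in> ?J"
      using r F assms(7) by (intro is_idealD[OF J]) auto
    finally have "extend r \<in> P"
      using assms(5) extend_in_rees_ideal_iff[OF assms(1)] by blast
    from is_idealD(2)[OF P r this] have "in_x (s None) ^ N * F \<in> P"
      by simp
    moreover have "in_x (s None) \<notin> P"
      using assms(3,7) by (auto simp: rees_ideal_def rees_map_in_x)
    ultimately show "F \<in> P"
      using prime_ideal_powerD[OF assms(4)] assms(4) by (metis prime_ideal_def)
  qed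
qed (rule assms(7))

theorem proposition4p2:
  fixes G G' :: "'n::finite \<Rightarrow> ('n, 'k::field) mpoly"
    and f g :: "('n, 'k) mpoly"
    and d d' e :: nat
    and D :: "('n, 'n option, 'k) bipoly \<Rightarrow> nat \<Rightarrow> ('n, 'n option, 'k) bipoly"
  assumes "infinite (UNIV :: 'k set)"
    and "cremona_map d G"
    and "\<forall>i. homogeneous d' (G' i)" and "gcd_one (range G')" and "inverse_rational_maps G G'"
    and "homogeneous e f" and "f \<noteq> 0" and "e \<ge> 1"
    and "homogeneous (d + e) g" and "g \<noteq> 0"
    and "gcd_one {f, g}"
    and "\<forall>Q\<in>syzygy_biforms (J_gens f G g). downgrade_iterates G' Q (D Q)"
  shows "minimal_prime_of
           (ideal_of (extend ` rees_ideal G \<union>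
              {D Q l |Q l. Q \<in> syzygy_biforms (J_gens f G g) \<and> l \<le> deg_x Q}))
           (rees_ideal (J_gens f G g))"
proof -
  let ?J = "rees_ideal (J_gens f G g)"
  let ?S = "syzygy_biforms (J_gens f G g)"
  let ?A = "extend ` rees_ideal G \<union> {D Q l |Q l. Q \<in> ?S \<and> l \<le> deg_x Q}"
  \<comment> \<open>If all \<open>g\<^sub>i\<close> were zero, they would have \<open>0\<close> as a common factor.\<close>
  have "\<exists>i. G i \<noteq> 0"
  proof (rule ccontr)
    assume "\<nexists>i. G i \<noteq> 0"
    then have "(0 :: ('n, 'k) mpoly) dvd 1"
      using assms(2) unfolding cremona_map_def gcd_one_def by (metis rangeE dvd_refl)
    then show False by simp
  qed
  then obtain i where "G i \<noteq> 0" ..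
  moreover have "\<forall>i. homogeneous d (G i)"
    using assms(2) by (simp add: cremona_map_def)
  ultimately obtain s where s: "homogeneous_syzygy (J_gens f G g) s" "s None \<noteq> 0"
    using ex_syzygy_last_neq_0[OF _ assms(6,9,7)] by metis
  have iterates: "downgrade_iterates G' Q (D Q)" if "Q \<in> ?S" for Q
    using that assms(12) by blast
  have biform_s: "biform s \<in> ?S"
    using s unfolding syzygy_biforms_def by blast
  have "D (biform s) 0 = biform s"
    using iterates[OF biform_s] by (simp add: downgrade_iterates_def)
  then have "biform s \<in> ?A"
    using biform_s by (intro UnI2 CollectI exI[of _ "biform s"] exI[of _ 0] conjI) simp_all
  then have contains: "extend ` rees_ideal G \<subseteq> ideal_of ?A" "biform s \<in> ideal_of ?A"
    using subset_ideal_of[of ?A] by (meson Un_subset_iff subset_trans subsetD)+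
  have "D Q l \<in> ?J" if "Q \<in> ?S" "l \<le> deg_x Q" for Q l
  proof (rule downgrade_iterates_in_rees_ideal)
    show "\<forall>i. homogeneous d' (G' i)" by (rule assms(3))
    show "same_rational_map (composite G' G) Var"
      using assms(5) by (simp add: inverse_rational_maps_def)
    show "downgrade_iterates G' Q (D Q)" by (rule iterates[OF that(1)])
    show "Q \<in> ?J"
      using that(1) biform_in_rees_ideal by (auto simp: syzygy_biforms_def)
  qed (rule that(2))
  then have "?A \<subseteq> ?J"
    by (intro Un_least image_subsetI subsetI) (auto simp: extend_in_rees_ideal_iff[OF \<open>f \<noteq> 0\<close>])
  then have "ideal_of ?A \<subseteq> ?J"
    using prime_ideal_rees_ideal by (intro ideal_of_least) (auto simp: prime_ideal_def)
  moreover have "P = ?J" if "prime_ideal P" "ideal_of ?A \<subseteq> P" "P \<subseteq> ?J" for P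
    using that(2) contains
    by (intro prime_between_is_rees_ideal[OF \<open>f \<noteq> 0\<close> s that(1) _ _ that(3)]) (simp_all add: subset_iff)
  ultimately show ?thesis
    unfolding minimal_prime_of_def by (intro conjI allI impI prime_ideal_rees_ideal) simp_all
qed

end
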